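(* Let $q,m,n$ be integers with $n>m$ such that one of the following holds: (a) $q=2$, $m=3$; (b) $q=3$, $m=2$; (c) $q\ge 4$, $m=1$. Then \[\sum_{k=m}^{n-1} q^{2(n-k)}\genfrac{[}{]}{0pt}{0}{n}{k}_q^2\,(q^k)!\,(q^n-q^k)!<(q^n)!.\]
   Context: $\genfrac{[}{]}{0pt}{0}{n}{k}_q=\frac{(q^n-1)(q^{n-1}-1)\cdots(q^{n-k+1}-1)}{(q^k-1)(q^{k-1}-1)\cdots(q-1)}$ is the Gaussian binomial coefficient. *)

theory Defs
  imports Complex_Main
begin

definition gauss_binomial :: "'a::field \<Rightarrow> nat \<Rightarrow> nat \<Rightarrow> 'a" where
  "gauss_binomial q n k = (\<Prod>i<k. q ^ (n - i) - 1) / (\<Prod>i=1..k. q ^ i - 1)"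

end

theory Submission
  imports Defs
begin

text \<open>Divided by \<open>(q^n)!\<close>, the \<open>k\<close>-th summand is
  \<open>q^(2(n-k)) * G^2 / (q^n choose q^k)\<close> where \<open>G\<close> is the Gaussian binomial. Since
  \<open>G \<le> c * q^(k(n-k))\<close> with \<open>1/c\<close> a lower bound of the product of the \<open>1 - q^(-j)\<close>, while
  \<open>q^n choose q^k\<close> is at least \<open>q^((n-k) q^k)\<close>, this quotient is at most \<open>2^(-(k-m+1))\<close>, and
  the sum of these bounds is below \<open>1\<close>. The crude bound of the binomial coefficient only fails
  for the boundary cases \<open>(q,k) = (4,1)\<close> and \<open>(2,3)\<close>, in which the exponents of \<open>q\<close> balance;
  there the quotient is a rational function of \<open>q^n\<close>.\<close>

section \<open>Lower bounds for finite products of 1 - q^(-j)\<close>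

lemma prod_one_minus_half_powers_ge:
  "(1/4::real) + (1/2)^(k+2) \<le> (\<Prod>j=1..Suc k. 1 - (1/2)^j)"
proof (induction k)
  case 0
  then show ?case by simp
next
  case (Suc k)
  \<comment> \<open>The surplus over 1/4 carries the induction: the new factor \<open>1 - a\<close>
    leaves at least half of the surplus \<open>a\<close>. This needs \<open>a \<le> 1/4\<close>, so
    the induction starts with one factor rather than none.\<close>
  define a :: real where "a = (1/2)^(k+2)"
  have "(1/2::real)^k \<le> 1" by (simp add: power_le_one)
  then have a: "0 < a" "a \<le> 1/4" by (auto simp: a_def)
  have "a * a \<le> a * (1/4)" using a by (intro mult_left_mono) auto
  moreover have "(1/4 + a) * (1 - a) = 1/4 + 3/4 * a - a * a"
    by (simp add: field_simps)
  ultimately have "1/4 + a/2 \<le> (1/4 + a) * (1 - a)" using a by linarith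
  also have "\<dots> \<le> (\<Prod>j=1..Suc k. 1 - (1/2)^j) * (1 - a)"
    using Suc a by (intro mult_right_mono) (auto simp: a_def)
  also have "\<dots> = (\<Prod>j=1..Suc (Suc k). 1 - (1/2)^j)"
    by (simp add: a_def)
  finally show ?case by (simp add: a_def)
qed

text \<open>Again a surplus over the limiting bound carries the induction: it may shrink by a factor
  3 at each step, and \<open>b * b \<le> b\<close> suffices, so the empty product can be the
  base.\<close>

lemma prod_one_minus_third_powers_ge:
  "(1/2::real) + (1/3)^k / 2 \<le> (\<Prod>j=1..k. 1 - (1/3)^j)"
proof (induction k)
  case 0
  then show ?case by simp
next
  case (Suc k)
  define b :: real where "b = (1/3)^k"
  have b: "0 < b" "b \<le> 1" by (auto simp: b_def power_le_one)
  have "b * b \<le> b * 1" using b by (intro mult_left_mono) auto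
  then have "1/2 + b/6 \<le> (1/2 + b/2) * (1 - b/3)"
    by (simp add: algebra_simps)
  also have "\<dots> \<le> (\<Prod>j=1..k. 1 - (1/3)^j) * (1 - b/3)"
    using Suc b by (intro mult_right_mono) (auto simp: b_def)
  also have "\<dots> = (\<Prod>j=1..Suc k. 1 - (1/3)^j)"
    by (simp add: b_def)
  finally show ?case by (simp add: b_def)
qed

section \<open>Upper bound of the Gaussian binomial\<close>

lemma gauss_binomial_nonneg:
  fixes q :: real
  assumes "1 \<le> q"
  shows "0 \<le> gauss_binomial q n k"
  unfolding gauss_binomial_def using assms
  by (intro divide_nonneg_nonneg prod_nonneg) auto

text \<open>Dropping the -1 in the numerator leaves factors \<open>q^(n-k) * q^(k-i)\<close>; the
  denominator has factors \<open>(1 - (1/q)^j) * q^j\<close>. The product \<open>P\<close> of the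
  \<open>q^j\<close> cancels.\<close>

lemma gauss_binomial_le:
  fixes q a :: real
  assumes "1 < q" "k \<le> n" "0 < a" "a \<le> (\<Prod>j=1..k. 1 - (1/q)^j)"
  shows "gauss_binomial q n k \<le> 1/a * q ^ (k * (n - k))"
proof -
  define P where "P = (\<Prod>j=1..k. q^j)"
  have P: "0 < P" unfolding P_def using assms by (intro prod_pos) auto
  have "(\<Prod>i<k. q^(n-i) - 1) \<le> (\<Prod>i<k. q^(n-k) * q^(k-i))"
  proof (rule prod_mono)
    fix i assume "i \<in> {..<k}"
    then have "n - i = (n - k) + (k - i)" using assms by auto
    then have "q^(n-i) = q^(n-k) * q^(k-i)" by (simp only: power_add)
    moreover have "1 \<le> q^(n-i)" using assms by (intro one_le_power) auto
    ultimately show "0 \<le> q^(n-i) - 1 \<and> q^(n-i) - 1 \<le> q^(n-k) * q^(k-i)" by simp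
  qed
  also have "\<dots> = q^(k*(n-k)) * (\<Prod>i<k. q^(k-i))"
    by (simp add: prod.distrib mult.commute flip: power_mult)
  also have "(\<Prod>i<k. q^(k-i)) = P"
    unfolding P_def
    by (rule prod.reindex_bij_witness[of _ "\<lambda>j. k - j" "\<lambda>i. k - i"]) auto
  finally have num: "(\<Prod>i<k. q^(n-i) - 1) \<le> q^(k*(n-k)) * P" .
  have "a * P \<le> (\<Prod>j=1..k. 1 - (1/q)^j) * P"
    using assms P by (intro mult_right_mono) auto
  also have "\<dots> = (\<Prod>j=1..k. (1 - (1/q)^j) * q^j)"
    by (simp add: P_def prod.distrib)
  also have "\<dots> = (\<Prod>j=1..k. q^j - 1)"
    using assms by (intro prod.cong) (auto simp: field_simps)
  finally have den: "a * P \<le> (\<Prod>j=1..k. q^j - 1)" .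
  have "gauss_binomial q n k \<le> (q^(k*(n-k)) * P) / (a * P)"
    unfolding gauss_binomial_def using num den assms P
    by (intro frac_le) auto
  then show ?thesis using P by simp
qed

section \<open>Bounds of the single summands\<close>

lemma summand_eq_divide_binomial:
  fixes K N :: nat and w :: real
  assumes "K \<le> N"
  shows "w * fact K * fact (N - K) = w / real (N choose K) * fact N"
  using assms by (simp add: binomial_fact)

text \<open>Exponents of \<open>q\<close> are compared: \<open>q^s\<close> pays for the constant
  \<open>c\<^sup>2\<close> and the gain \<open>2^r\<close>. With \<open>d = n - k \<ge> 1\<close>,
  enlarging \<open>s\<close> to \<open>s*d\<close> makes every exponent a multiple of
  \<open>d\<close>, so that condition \<open>e\<close> is free of \<open>n\<close>.\<close>

lemma summand_le:
  fixes q n k r s :: nat and c :: real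
  assumes "2 \<le> q" "k < n" and G: "gauss_binomial (real q) n k \<le> c * real q ^ (k * (n - k))"
    and c: "c\<^sup>2 * 2^r \<le> real q ^ s" and e: "2*k + 2 + s \<le> q^k"
  shows "real q ^ (2*(n-k)) * (gauss_binomial (real q) n k)\<^sup>2 * fact (q^k) * fact (q^n - q^k)
    \<le> (1/2)^r * fact (q^n)"
proof -
  define d where "d = n - k"
  define w where "w = real q ^ (2*d) * (gauss_binomial (real q) n k)\<^sup>2"
  have d: "1 \<le> d" "n = k + d" using assms by (auto simp: d_def)
  have le: "q^k \<le> q^n" using assms by (intro power_increasing) auto
  have "(gauss_binomial (real q) n k)\<^sup>2 \<le> (c * real q ^ (k*d))\<^sup>2"
    using G assms(1) by (intro power_mono gauss_binomial_nonneg) (auto simp: d_def)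
  then have "w * 2^r \<le> real q^(2*d) * (c * real q ^ (k*d))\<^sup>2 * 2^r"
    unfolding w_def by (intro mult_right_mono mult_left_mono) auto
  also have "\<dots> = real q^(2*d + 2*k*d) * (c\<^sup>2 * 2^r)"
    by (simp add: power_add power_mult_distrib mult_ac flip: power_mult)
  also have "\<dots> \<le> real q^(2*d + 2*k*d) * real q^s"
    using c by (intro mult_left_mono) auto
  also have "\<dots> = real q^(2*d + 2*k*d + s)" by (simp add: power_add)
  also have "\<dots> \<le> real q^(d * q^k)"
  proof (rule power_increasing)
    have "2*d + 2*k*d + s \<le> 2*d + 2*k*d + s*d" using d by simp
    also have "\<dots> = (2*k + 2 + s) * d" by (simp add: algebra_simps)
    also have "\<dots> \<le> q^k * d" using e by (rule mult_right_mono) simp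
    finally show "2*d + 2*k*d + s \<le> d * q^k" by (simp add: mult.commute)
  qed (use assms in auto)
  also have "\<dots> = (real (q^n) / real (q^k)) ^ (q^k)"
    using assms d by (simp add: power_add power_mult)
  also have "\<dots> \<le> real (q^n choose q^k)"
    using binomial_ge_n_over_k_pow_k[OF le, where 'a = real] by simp
  finally have "w * 2^r \<le> real (q^n choose q^k)" .
  moreover have "0 < real (q^n choose q^k)" using le by simp
  ultimately have "w / real (q^n choose q^k) \<le> (1/2)^r"
    by (simp add: field_simps)
  then show ?thesis
    unfolding summand_eq_divide_binomial[OF le] w_def d_def
    by (intro mult_right_mono) auto
qed

text \<open>Here \<open>2*k + 2 = q^k\<close>, which leaves no room for \<open>s > 0\<close>. In
  terms of \<open>N\<close>, the weight is a multiple of \<open>X * X\<close> and the binomial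
  coefficient one of \<open>X * Y\<close>, so comparing \<open>X\<close> with \<open>Y\<close> is
  enough.\<close>

lemma summand_le_2_3:
  assumes "3 < n"
  shows "real 2 ^ (2*(n-3)) * (gauss_binomial (real 2) n 3)\<^sup>2 * fact (2^3) * fact (2^n - 2^3)
    \<le> 1/2 * fact (2^n)"
proof -
  define l where "l = n - 4"
  have l: "n = l + 4" using assms by (simp add: l_def)
  define N where "N = (2::real)^n"
  have N: "16 \<le> N" by (simp add: N_def l power_add)
  \<comment> \<open>168 is the denominator 7 * 3 * 1 times the 8 that clears N/2 - 1 and N/4 -
    1.\<close>
  have G: "gauss_binomial (2::real) n 3 = (N-1)*(N-2)*(N-4)/168"
    by (simp add: gauss_binomial_def N_def l numeral_3_eq_3 atLeastAtMostSuc_conv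
        lessThan_Suc power_add field_simps eval_nat_numeral)
  have Q: "(2::real)^(2*(n-3)) = N^2/64"
  proof -
    have "2*(n-3) = (n-3)*2" by simp
    moreover have "N = 2^(n-3) * 8" using l by (simp add: N_def power_add)
    ultimately show ?thesis by (simp only: power_mult power_mult_distrib) simp
  qed
  have B: "real (2^n choose 2^3) = N*(N-1)*(N-2)*(N-3)*(N-4)*(N-5)*(N-6)*(N-7)/40320"
    by (simp add: binomial_gbinomial gbinomial_prod_rev N_def fact_numeral
        atLeastLessThan_nat_numeral mult_ac)
  define X where "X = N*(N-1)*(N-2)*(N-4)"
  define Y where "Y = (N-7)*(N-6)*(N-5)*(N-3)"
  \<comment> \<open>Factors are paired off; the tightest pair, \<open>N \<le> 2*(N-7)\<close>, needs
    only \<open>N \<ge> 14\<close>. The resulting 16 suffices because 16 * 2 * 40320 < 64 * 168 *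
    168.\<close>
  have "X \<le> (2*(N-7))*(2*(N-6))*(2*(N-5))*(2*(N-3))"
    unfolding X_def using N by (intro mult_mono) auto
  also have "\<dots> = 16 * Y" unfolding Y_def by algebra
  finally have "X \<le> 16 * Y" .
  moreover have X: "0 \<le> X" using N by (simp add: X_def)
  ultimately have "X * X \<le> 16 * Y * X" by (intro mult_right_mono)
  moreover have "0 \<le> Y * X" using N X by (simp add: Y_def)
  ultimately have "X * X / (64 * 168 * 168) \<le> 1/2 * (X * Y / 40320)"
    by (simp add: mult.commute)
  also have "X * Y = N*(N-1)*(N-2)*(N-3)*(N-4)*(N-5)*(N-6)*(N-7)"
    by (simp only: X_def Y_def mult_ac)
  also have "X * X / (64 * 168 * 168) = N^2/64 * ((N-1)*(N-2)*(N-4)/168)^2"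
    by (simp add: X_def power2_eq_square)
  finally have "(2::real)^(2*(n-3)) * (gauss_binomial 2 n 3)\<^sup>2 \<le> 1/2 * real (2^n choose 2^3)"
    unfolding G Q B .
  moreover have le: "2^3 \<le> (2::nat)^n" using assms by (intro power_increasing) auto
  moreover have "0 < real (2^n choose 2^3)" using le by simp
  ultimately have "(2::real)^(2*(n-3)) * (gauss_binomial 2 n 3)\<^sup>2 / real (2^n choose 2^3) \<le> 1/2"
    by (simp only: pos_divide_le_eq)
  then show ?thesis
    unfolding summand_eq_divide_binomial[OF le] of_nat_numeral
    by (intro mult_right_mono) auto
qed

lemma summand_le_4_1:
  assumes "1 < n"
  shows "real 4 ^ (2*(n-1)) * (gauss_binomial (real 4) n 1)\<^sup>2 * fact (4^1) * fact (4^n - 4^1)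
    \<le> 1/2 * fact (4^n)"
proof -
  define l where "l = n - 2"
  have l: "n = l + 2" using assms by (simp add: l_def)
  define N where "N = (4::real)^n"
  have N: "16 \<le> N" by (simp add: N_def l power_add)
  have G: "gauss_binomial (4::real) n 1 = (N-1)/3"
    by (simp add: gauss_binomial_def N_def)
  have Q: "(4::real)^(2*(n-1)) = N^2/16"
    by (simp add: N_def l power_add power2_eq_square mult_2)
  have B: "real (4^n choose 4^1) = N*(N-1)*(N-2)*(N-3)/24"
    by (simp add: binomial_gbinomial gbinomial_prod_rev N_def eval_nat_numeral fact_numeral
        atLeast0_lessThan_Suc algebra_simps)
  \<comment> \<open>The goal is \<open>X \<le> 3 * Y\<close>, where 3 is exactly the admissible
    ratio (16 * 3 * 3) / (2 * 24).\<close>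
  have "7*N \<le> N*N" using N by (intro mult_right_mono) auto
  define X where "X = N*(N-1)"
  define Y where "Y = (N-2)*(N-3)"
  have "3 * Y = X + 2 * (N*N) - 14 * N + 18" by (simp add: X_def Y_def algebra_simps)
  then have "X \<le> 3 * Y" using \<open>7*N \<le> N*N\<close> by linarith
  moreover have "0 \<le> X" using N by (simp add: X_def)
  ultimately have "X * X \<le> 3 * Y * X" by (intro mult_right_mono)
  then have "X * X / (16 * 3 * 3) \<le> 1/2 * (X * Y / 24)" by (simp add: mult.commute)
  also have "X * Y = N*(N-1)*(N-2)*(N-3)"
    by (simp only: X_def Y_def mult_ac)
  also have "X * X / (16 * 3 * 3) = N^2/16 * ((N-1)/3)^2"
    by (simp add: X_def power2_eq_square)
  finally have "(4::real)^(2*(n-1)) * (gauss_binomial 4 n 1)\<^sup>2 \<le> 1/2 * real (4^n choose 4^1)"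
    unfolding G Q B .
  moreover have le: "4^1 \<le> (4::nat)^n" using assms by (intro power_increasing) auto
  moreover have "0 < real (4^n choose 4^1)" using le by simp
  ultimately have "(4::real)^(2*(n-1)) * (gauss_binomial 4 n 1)\<^sup>2 / real (4^n choose 4^1) \<le> 1/2"
    by (simp only: pos_divide_le_eq)
  then show ?thesis
    unfolding summand_eq_divide_binomial[OF le] of_nat_numeral
    by (intro mult_right_mono) auto
qed

text \<open>The product bound 1/4 gives \<open>c = 4\<close>, and
  \<open>4\<^sup>2 * 2^(k-2) = 2^(k+2)\<close> dictates \<open>s\<close>. The exponent condition
  becomes \<open>3*k + 4 \<le> 2^k\<close>, an equality at \<open>k = 4\<close>.\<close>

lemma summand_le_two:
  assumes "4 \<le> k" "k < n"
  shows "real 2 ^ (2*(n-k)) * (gauss_binomial (real 2) n k)\<^sup>2 * fact (2^k) * fact (2^n - 2^k)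
    \<le> (1/2)^(k-2) * fact (2^n)"
proof (rule summand_le[where c = 4 and s = "k+2"])
  obtain k' where k': "k = Suc k'" using assms by (cases k) auto
  have "1/4 \<le> (\<Prod>j=1..k. 1 - (1/real 2)^j)"
    using prod_one_minus_half_powers_ge[of k'] zero_le_power[of "1/2::real" "k'+2"]
    unfolding k' of_nat_numeral by linarith
  then show "gauss_binomial (real 2) n k \<le> 4 * real 2 ^ (k * (n - k))"
    using gauss_binomial_le[of "real 2" k n "1/4"] assms by simp
  have "k + 2 = (k - 2) + 4" using assms by simp
  then have "(2::real)^(k+2) = 2^(k-2) * 2^4" by (metis power_add)
  then show "4\<^sup>2 * 2^(k-2) \<le> real 2 ^ (k+2)" by simp
  show "2*k + 2 + (k+2) \<le> 2^k"
    using assms(1) by (induction k rule: dec_induct) auto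
qed (use assms in auto)

text \<open>The product of the 1 - q^(-j) grows with \<open>q\<close>, so its bound at 3 serves all
  larger \<open>q\<close>.\<close>

lemma gauss_binomial_le_2:
  fixes q :: real
  assumes "3 \<le> q" "k \<le> n"
  shows "gauss_binomial q n k \<le> 2 * q ^ (k * (n - k))"
proof -
  have "1/2 \<le> (\<Prod>j=1..k. 1 - (1/3::real)^j)"
    using prod_one_minus_third_powers_ge[of k] zero_le_power[of "1/3::real" k] by linarith
  also have "\<dots> \<le> (\<Prod>j=1..k. 1 - (1/q)^j)"
    using assms by (intro prod_mono) (auto intro!: power_mono simp: power_le_one frac_le)
  finally show ?thesis using gauss_binomial_le[of q k n "1/2"] assms by simp
qed

lemma summand_le_ge_3:
  fixes q :: nat
  assumes "3 \<le> q" "k < n" "2*k + 4 + r \<le> q^k"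
  shows "real q ^ (2*(n-k)) * (gauss_binomial (real q) n k)\<^sup>2 * fact (q^k) * fact (q^n - q^k)
    \<le> (1/2)^r * fact (q^n)"
proof (rule summand_le[where c = 2 and s = "r+2"])
  show "gauss_binomial (real q) n k \<le> 2 * real q ^ (k * (n - k))"
    using assms by (intro gauss_binomial_le_2) auto
  have "(2::real)^(r+2) \<le> real q ^ (r+2)" using assms by (intro power_mono) auto
  then show "2\<^sup>2 * 2^r \<le> real q ^ (r+2)" by (simp add: power_add)
qed (use assms in auto)

text \<open>For \<open>k = r = 1\<close>, \<open>summand_le_ge_3\<close> would require
  \<open>q \<ge> 7\<close>. The single factor 1 - 1/q \<ge> 4/5 gives the sharper
  \<open>c = 5/4\<close>, for which \<open>s = 1\<close> is enough.\<close>

lemma summand_le_ge_5_1: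
  fixes q :: nat
  assumes "5 \<le> q" "1 < n"
  shows "real q ^ (2*(n-1)) * (gauss_binomial (real q) n 1)\<^sup>2 * fact (q^1) * fact (q^n - q^1)
    \<le> (1/2)^1 * fact (q^n)"
proof (rule summand_le[where c = "5/4" and s = 1])
  have "4/5 \<le> (\<Prod>j=1..1. 1 - (1/real q)^j)"
    using assms by (simp add: field_simps)
  then show "gauss_binomial (real q) n 1 \<le> 5/4 * real q ^ (1 * (n - 1))"
    using gauss_binomial_le[of "real q" 1 n "4/5"] assms by simp
  show "(5/4)\<^sup>2 * 2^1 \<le> real q ^ 1" using assms by (simp add: power2_eq_square)
qed (use assms in auto)

section \<open>Summation of the bounds\<close>

lemma sum_half_powers_less_1:
  assumes "m < n"
  shows "(\<Sum>k=m..n-1. (1/2::real)^(k+1-m)) < 1"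
proof -
  have "(\<Sum>k=m..m+l. (1/2::real)^(k+1-m)) = 1 - (1/2)^Suc l" for l
    by (induction l) auto
  from this[of "n - 1 - m"] show ?thesis using assms by simp
qed

text \<open>These are the exponent conditions \<open>2*k + 4 + r \<le> q^k\<close> for
  \<open>r = k + 1 - m\<close>, with \<open>m = 2\<close> and \<open>m = 1\<close> respectively. The
  first is sharp at \<open>q = 3\<close>, \<open>k = 2\<close>.\<close>

lemma three_times_le_power:
  fixes q :: nat
  assumes "2 \<le> k" "3 \<le> q"
  shows "3*k + 3 \<le> q^k" and "4 \<le> q \<Longrightarrow> 3*k + 4 \<le> q^k"
proof -
  have "3*k + 3 \<le> 3^k" using assms(1) by (induction k rule: dec_induct) auto
  also have "\<dots> \<le> q^k" using assms by (intro power_mono) auto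
  finally show "3*k + 3 \<le> q^k" .
  have "3*k + 4 \<le> 4^k" using assms(1) by (induction k rule: dec_induct) auto
  also have "\<dots> \<le> q^k" if "4 \<le> q" using that by (intro power_mono) auto
  finally show "3*k + 4 \<le> q^k" if "4 \<le> q" using that .
qed

theorem theorem2p3:
  fixes q m n :: nat
  assumes "m < n"
    and "(q = 2 \<and> m = 3) \<or> (q = 3 \<and> m = 2) \<or> (q \<ge> 4 \<and> m = 1)"
  shows "(\<Sum>k=m..n-1. real q ^ (2 * (n - k)) * (gauss_binomial (real q) n k)\<^sup>2
            * fact (q ^ k) * fact (q ^ n - q ^ k)) < (fact (q ^ n) :: real)"
proof -
  have "(\<Sum>k=m..n-1. real q ^ (2 * (n - k)) * (gauss_binomial (real q) n k)\<^sup>2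
            * fact (q ^ k) * fact (q ^ n - q ^ k))
    \<le> (\<Sum>k=m..n-1. (1/2)^(k+1-m) * fact (q ^ n))"
  proof (rule sum_mono)
    fix k assume "k \<in> {m..n-1}"
    then have k: "m \<le> k" "k < n" using assms(1) by auto
    \<comment> \<open>The first and fourth cases are those with balanced exponents; the fifth is
      split off because the generic bound at \<open>k = 1\<close> misses \<open>q = 5\<close> and
      \<open>q = 6\<close>.\<close>
    consider "q = 2" "m = 3" "k = 3" | "q = 2" "m = 3" "4 \<le> k" | "q = 3" "m = 2"
      | "q = 4" "m = 1" "k = 1" | "5 \<le> q" "m = 1" "k = 1" | "4 \<le> q" "m = 1" "2 \<le> k"
      using assms(2) k(1) by linarith
    then show "real q ^ (2 * (n - k)) * (gauss_binomial (real q) n k)\<^sup>2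
            * fact (q ^ k) * fact (q ^ n - q ^ k) \<le> (1/2)^(k+1-m) * fact (q ^ n)"
    proof cases
      case 1
      then show ?thesis using summand_le_2_3[of n] k by simp
    next
      case 2
      have "k + 1 - m = k - 2" using 2 by simp
      then show ?thesis using summand_le_two[of k n] k 2 by simp
    next
      case 3
      show ?thesis
        by (rule summand_le_ge_3) (use three_times_le_power(1)[of k q] 3 k in auto)
    next
      case 4
      then show ?thesis using summand_le_4_1[of n] k by simp
    next
      case 5
      then show ?thesis using summand_le_ge_5_1[of q n] k by simp
    next
      case 6
      show ?thesis
        by (rule summand_le_ge_3) (use three_times_le_power(2)[of k q] 6 k in auto)
    qed
  qed
  also have "\<dots> = (\<Sum>k=m..n-1. (1/2)^(k+1-m)) * fact (q ^ n)"
    by (simp add: sum_distrib_right)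
  also have "\<dots> < 1 * fact (q ^ n)"
    using sum_half_powers_less_1[OF assms(1)] by (intro mult_strict_right_mono) auto
  finally show ?thesis by simp
qed

end
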